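(* Let $X$ be a small category, $A$ a discrete fibration over $X$ and $D$ a discrete opfibration over $X$. Then for any $P\in\mathbf{Cat}/X$, with reflection ${\downarrow}P$ in discrete fibrations and reflection ${\uparrow}P$ in discrete opfibrations, there are natural bijections $$\mathrm{ten}(P,A)\cong\mathrm{ten}({\uparrow}P,A),\qquad \mathrm{ten}(P,D)\cong\mathrm{ten}({\downarrow}P,D).$$
   Context: $\mathbf{Cat}/X$ is the slice category: objects are functors $\pi:P\to X$ with $P$ small (denoted simply $P$), morphisms are functors commuting with the projections to $X$. $P$ is a discrete fibration if for every object $a$ of $P$ and every arrow $f:y\to\pi a$ of $X$ there is a unique arrow of $P$ with codomain $a$ lying over $f$; a discrete opfibration is defined dually. $\overleftarrow{X}$ and $\overrightarrow{X}$ denote the full subcategories of $\mathbf{Cat}/X$ given by discrete fibrations and discrete opfibrations respectively. ${\downarrow}(-):\mathbf{Cat}/X\to\overleftarrow{X}$ and ${\uparrow}(-):\mathbf{Cat}/X\to\overrightarrow{X}$ are the left adjoints of the inclusions. For $P,Q\in\mathbf{Cat}/X$, $\mathrm{ten}(P,Q)$ is the set of connected components of the total category of the product $P\times Q$ in $\mathbf{Cat}/X$ (i.e. of the pullback $P\times_X Q$). *)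

theory Defs
  imports Main "HOL-Library.FuncSet"
begin

section \<open>Categories and functors\<close>

record ('o, 'a) cat =
  Obj :: "'o set"
  Arr :: "'a set"
  Dom :: "'a \<Rightarrow> 'o"
  Cod :: "'a \<Rightarrow> 'o"
  Ide :: "'o \<Rightarrow> 'a"
  Comp :: "'a \<Rightarrow> 'a \<Rightarrow> 'a"  \<comment> \<open>\<open>Comp C g f\<close> is \<open>g\<close> after \<open>f\<close>\<close>

locale category =
  fixes C :: "('o, 'a) cat"
  assumes dom_in_Obj: "f \<in> Arr C \<Longrightarrow> Dom C f \<in> Obj C"
    and cod_in_Obj: "f \<in> Arr C \<Longrightarrow> Cod C f \<in> Obj C"
    and ide_in_Arr: "a \<in> Obj C \<Longrightarrow> Ide C a \<in> Arr C"
    and dom_ide: "a \<in> Obj C \<Longrightarrow> Dom C (Ide C a) = a"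
    and cod_ide: "a \<in> Obj C \<Longrightarrow> Cod C (Ide C a) = a"
    and comp_in_Arr: "\<lbrakk>f \<in> Arr C; g \<in> Arr C; Dom C g = Cod C f\<rbrakk> \<Longrightarrow> Comp C g f \<in> Arr C"
    and dom_comp: "\<lbrakk>f \<in> Arr C; g \<in> Arr C; Dom C g = Cod C f\<rbrakk> \<Longrightarrow> Dom C (Comp C g f) = Dom C f"
    and cod_comp: "\<lbrakk>f \<in> Arr C; g \<in> Arr C; Dom C g = Cod C f\<rbrakk> \<Longrightarrow> Cod C (Comp C g f) = Cod C g"
    and comp_ide_right: "f \<in> Arr C \<Longrightarrow> Comp C f (Ide C (Dom C f)) = f"
    and comp_ide_left: "f \<in> Arr C \<Longrightarrow> Comp C (Ide C (Cod C f)) f = f"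
    and comp_assoc: "\<lbrakk>f \<in> Arr C; g \<in> Arr C; h \<in> Arr C; Dom C g = Cod C f; Dom C h = Cod C g\<rbrakk>
      \<Longrightarrow> Comp C h (Comp C g f) = Comp C (Comp C h g) f"

record ('o1, 'a1, 'o2, 'a2) funct =
  on_obj :: "'o1 \<Rightarrow> 'o2"
  on_arr :: "'a1 \<Rightarrow> 'a2"

text \<open>Both components of a functor are extensional functions on the carriers of the source, so
  that two functors are equal as records iff they agree on the objects and arrows of the source.\<close>

definition functs :: "('o1, 'a1) cat \<Rightarrow> ('o2, 'a2) cat \<Rightarrow> ('o1, 'a1, 'o2, 'a2) funct set" where
  "functs C D = {F.
     on_obj F \<in> Obj C \<rightarrow>\<^sub>E Obj D \<and>
     on_arr F \<in> Arr C \<rightarrow>\<^sub>E Arr D \<and>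
     (\<forall>f\<in>Arr C. Dom D (on_arr F f) = on_obj F (Dom C f) \<and>
                 Cod D (on_arr F f) = on_obj F (Cod C f)) \<and>
     (\<forall>a\<in>Obj C. on_arr F (Ide C a) = Ide D (on_obj F a)) \<and>
     (\<forall>f\<in>Arr C. \<forall>g\<in>Arr C. Dom C g = Cod C f \<longrightarrow>
        on_arr F (Comp C g f) = Comp D (on_arr F g) (on_arr F f))}"

definition id_funct :: "('o, 'a) cat \<Rightarrow> ('o, 'a, 'o, 'a) funct" where
  "id_funct C = \<lparr>on_obj = (\<lambda>a\<in>Obj C. a), on_arr = (\<lambda>f\<in>Arr C. f)\<rparr>"

definition comp_funct ::
  "('o1, 'a1) cat \<Rightarrow> ('o2, 'a2, 'o3, 'a3) funct \<Rightarrow> ('o1, 'a1, 'o2, 'a2) funct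
    \<Rightarrow> ('o1, 'a1, 'o3, 'a3) funct" where
  "comp_funct C G F = \<lparr>on_obj = compose (Obj C) (on_obj G) (on_obj F),
                       on_arr = compose (Arr C) (on_arr G) (on_arr F)\<rparr>"


section \<open>The slice category over a base category\<close>

record ('o, 'a, 'x, 'y) over =
  tot :: "('o, 'a) cat"
  proj :: "('o, 'a, 'x, 'y) funct"

definition slice_obj :: "('x, 'y) cat \<Rightarrow> ('o, 'a, 'x, 'y) over set" where
  "slice_obj X = {P. category (tot P) \<and> proj P \<in> functs (tot P) X}"

definition slice_hom ::
  "('o1, 'a1, 'x, 'y) over \<Rightarrow> ('o2, 'a2, 'x, 'y) over \<Rightarrow> ('o1, 'a1, 'o2, 'a2) funct set" where
  "slice_hom P Q = {F \<in> functs (tot P) (tot Q). comp_funct (tot P) (proj Q) F = proj P}"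

definition disc_fibs :: "('x, 'y) cat \<Rightarrow> ('o, 'a, 'x, 'y) over set" where
  "disc_fibs X = {P \<in> slice_obj X.
     \<forall>a\<in>Obj (tot P). \<forall>f\<in>Arr X. Cod X f = on_obj (proj P) a \<longrightarrow>
       (\<exists>!g. g \<in> Arr (tot P) \<and> Cod (tot P) g = a \<and> on_arr (proj P) g = f)}"

definition disc_opfibs :: "('x, 'y) cat \<Rightarrow> ('o, 'a, 'x, 'y) over set" where
  "disc_opfibs X = {P \<in> slice_obj X.
     \<forall>a\<in>Obj (tot P). \<forall>f\<in>Arr X. Dom X f = on_obj (proj P) a \<longrightarrow>
       (\<exists>!g. g \<in> Arr (tot P) \<and> Dom (tot P) g = a \<and> on_arr (proj P) g = f)}"


section \<open>Left adjoints of inclusions of full subcategories\<close>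

text \<open>The objects of the slice over \<open>X\<close> are here the small categories over \<open>X\<close> whose objects and
  arrows are elements of the type \<open>'u\<close>, which plays the role of the universe.  \<open>S\<close> is the object
  set of a full subcategory, the pair \<open>L\<close>, \<open>Lm\<close> is a functor from the slice to \<open>S\<close>, and \<open>eta\<close> is
  the unit of the adjunction: it is natural and each component is a universal arrow to the
  inclusion of \<open>S\<close>.  The source and target of a morphism are explicit arguments of \<open>Lm\<close>.\<close>

locale left_adjoint_of_inclusion =
  fixes X :: "('u, 'u) cat"
    and S :: "('u, 'u, 'u, 'u) over set"
    and L :: "('u, 'u, 'u, 'u) over \<Rightarrow> ('u, 'u, 'u, 'u) over"
    and Lm :: "('u, 'u, 'u, 'u) over \<Rightarrow> ('u, 'u, 'u, 'u) over
      \<Rightarrow> ('u, 'u, 'u, 'u) funct \<Rightarrow> ('u, 'u, 'u, 'u) funct"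
    and eta :: "('u, 'u, 'u, 'u) over \<Rightarrow> ('u, 'u, 'u, 'u) funct"
  assumes L_in: "P \<in> slice_obj X \<Longrightarrow> L P \<in> S"
    and Lm_in: "\<lbrakk>P \<in> slice_obj X; Q \<in> slice_obj X; F \<in> slice_hom P Q\<rbrakk>
      \<Longrightarrow> Lm P Q F \<in> slice_hom (L P) (L Q)"
    and Lm_id: "P \<in> slice_obj X \<Longrightarrow> Lm P P (id_funct (tot P)) = id_funct (tot (L P))"
    and Lm_comp: "\<lbrakk>P \<in> slice_obj X; Q \<in> slice_obj X; R \<in> slice_obj X;
        F \<in> slice_hom P Q; G \<in> slice_hom Q R\<rbrakk>
      \<Longrightarrow> Lm P R (comp_funct (tot P) G F)
          = comp_funct (tot (L P)) (Lm Q R G) (Lm P Q F)"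
    and eta_in: "P \<in> slice_obj X \<Longrightarrow> eta P \<in> slice_hom P (L P)"
    and eta_natural: "\<lbrakk>P \<in> slice_obj X; Q \<in> slice_obj X; F \<in> slice_hom P Q\<rbrakk>
      \<Longrightarrow> comp_funct (tot P) (Lm P Q F) (eta P) = comp_funct (tot P) (eta Q) F"
    and eta_universal: "\<lbrakk>P \<in> slice_obj X; A \<in> S; F \<in> slice_hom P A\<rbrakk>
      \<Longrightarrow> \<exists>!G. G \<in> slice_hom (L P) A \<and> comp_funct (tot P) G (eta P) = F"


section \<open>Products in the slice, connected components and the tensor\<close>

definition slice_prod ::
  "('o1, 'a1, 'x, 'y) over \<Rightarrow> ('o2, 'a2, 'x, 'y) over \<Rightarrow> ('o1 \<times> 'o2, 'a1 \<times> 'a2, 'x, 'y) over"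
where
  "slice_prod P Q = (let
     Ob = {(p, q). p \<in> Obj (tot P) \<and> q \<in> Obj (tot Q) \<and> on_obj (proj P) p = on_obj (proj Q) q};
     Ar = {(f, g). f \<in> Arr (tot P) \<and> g \<in> Arr (tot Q) \<and> on_arr (proj P) f = on_arr (proj Q) g}
   in \<lparr>tot = \<lparr>Obj = Ob, Arr = Ar,
                Dom = map_prod (Dom (tot P)) (Dom (tot Q)),
                Cod = map_prod (Cod (tot P)) (Cod (tot Q)),
                Ide = map_prod (Ide (tot P)) (Ide (tot Q)),
                Comp = (\<lambda>(g, g') (f, f'). (Comp (tot P) g f, Comp (tot Q) g' f'))\<rparr>,
       proj = \<lparr>on_obj = (\<lambda>(p, q)\<in>Ob. on_obj (proj P) p),
               on_arr = (\<lambda>(f, g)\<in>Ar. on_arr (proj P) f)\<rparr>\<rparr>)"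

definition conn_rel :: "('o, 'a) cat \<Rightarrow> ('o \<times> 'o) set" where
  "conn_rel C = (let r = {(Dom C f, Cod C f) | f. f \<in> Arr C} in (r \<union> r\<inverse>)\<^sup>*)"

definition components :: "('o, 'a) cat \<Rightarrow> 'o set set" where
  "components C = Obj C // conn_rel C"

definition ten ::
  "('o1, 'a1, 'x, 'y) over \<Rightarrow> ('o2, 'a2, 'x, 'y) over \<Rightarrow> ('o1 \<times> 'o2) set set" where
  "ten P Q = components (tot (slice_prod P Q))"

text \<open>The action of \<open>ten\<close> on morphisms \<open>F : P \<rightarrow> P'\<close> and \<open>G : Q \<rightarrow> Q'\<close>: the component \<open>K\<close> of \<open>(p, q)\<close>
  is sent to the component of \<open>(F p, G q)\<close>, obtained as the saturation of the image of \<open>K\<close>.\<close>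

definition ten_map ::
  "('o3, 'a3, 'x, 'y) over \<Rightarrow> ('o4, 'a4, 'x, 'y) over
    \<Rightarrow> ('o1, 'a1, 'o3, 'a3) funct \<Rightarrow> ('o2, 'a2, 'o4, 'a4) funct
    \<Rightarrow> ('o1 \<times> 'o2) set \<Rightarrow> ('o3 \<times> 'o4) set" where
  "ten_map P' Q' F G K =
     conn_rel (tot (slice_prod P' Q')) `` (map_prod (on_obj F) (on_obj G) ` K)"

end

theory Submission
  imports Defs
begin

text \<open>The bijection is induced by the unit \<open>eta : P \<rightarrow> U\<close> of the reflection of \<open>P\<close> in discrete
  opfibrations.  The key point is that \<open>eta\<close> is an initial functor: for every object \<open>u\<close> of \<open>U\<close> the
  comma category \<open>eta / u\<close> is nonempty and connected.  To see this, let \<open>E\<close> be the discrete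
  opfibration over \<open>U\<close> whose objects over \<open>u\<close> are the components of \<open>eta / u\<close>.  It is a discrete
  opfibration over \<open>X\<close>, it fits into the universe \<open>'u\<close> because \<open>'u \<times> 'u\<close> injects into \<open>'u\<close>, and \<open>eta\<close>
  lifts to it along \<open>p \<mapsto> [id]\<close>.  By universality the projection
  \<open>E \<rightarrow> U\<close> has a section \<open>G\<close> compatible with the lift; then \<open>G u\<close> witnesses nonemptiness, and
  \<open>G u = f\<^sub>* [id] = [f]\<close> for every \<open>f : eta p \<rightarrow> u\<close>, so there is only one component.
  Given initiality, the inverse on components sends the class of \<open>(u, a)\<close> to that of
  \<open>(p, f\<^sup>* a)\<close> for any \<open>f : eta p \<rightarrow> u\<close>.  The second bijection follows by passing to opposites.\<close>

section \<open>Functors and morphisms of the slice\<close>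

lemma functsD:
  assumes "F \<in> functs C D"
  shows "a \<in> Obj C \<Longrightarrow> on_obj F a \<in> Obj D"
    and "f \<in> Arr C \<Longrightarrow> on_arr F f \<in> Arr D"
    and "f \<in> Arr C \<Longrightarrow> Dom D (on_arr F f) = on_obj F (Dom C f)"
    and "f \<in> Arr C \<Longrightarrow> Cod D (on_arr F f) = on_obj F (Cod C f)"
    and "a \<in> Obj C \<Longrightarrow> on_arr F (Ide C a) = Ide D (on_obj F a)"
    and "\<lbrakk>f \<in> Arr C; g \<in> Arr C; Dom C g = Cod C f\<rbrakk>
      \<Longrightarrow> on_arr F (Comp C g f) = Comp D (on_arr F g) (on_arr F f)"
    and "on_obj F \<in> extensional (Obj C)"
    and "on_arr F \<in> extensional (Arr C)"
  using assms unfolding functs_def by (auto simp: PiE_def)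

lemma functsI:
  assumes "\<And>a. a \<in> Obj C \<Longrightarrow> on_obj F a \<in> Obj D"
    and "\<And>f. f \<in> Arr C \<Longrightarrow> on_arr F f \<in> Arr D"
    and "\<And>f. f \<in> Arr C \<Longrightarrow> Dom D (on_arr F f) = on_obj F (Dom C f)"
    and "\<And>f. f \<in> Arr C \<Longrightarrow> Cod D (on_arr F f) = on_obj F (Cod C f)"
    and "\<And>a. a \<in> Obj C \<Longrightarrow> on_arr F (Ide C a) = Ide D (on_obj F a)"
    and "\<And>f g. \<lbrakk>f \<in> Arr C; g \<in> Arr C; Dom C g = Cod C f\<rbrakk>
      \<Longrightarrow> on_arr F (Comp C g f) = Comp D (on_arr F g) (on_arr F f)"
    and "on_obj F \<in> extensional (Obj C)"
    and "on_arr F \<in> extensional (Arr C)"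
  shows "F \<in> functs C D"
  using assms unfolding functs_def by (auto simp: PiE_def)

section \<open>Composition and identities of functors and slice morphisms\<close>

lemma on_obj_comp_funct: "a \<in> Obj C \<Longrightarrow> on_obj (comp_funct C G F) a = on_obj G (on_obj F a)"
  by (simp add: comp_funct_def compose_def)

lemma on_arr_comp_funct: "f \<in> Arr C \<Longrightarrow> on_arr (comp_funct C G F) f = on_arr G (on_arr F f)"
  by (simp add: comp_funct_def compose_def)

lemma comp_funct_in_functs:
  assumes "category B" "F \<in> functs B C" "G \<in> functs C D"
  shows "comp_funct B G F \<in> functs B D"
proof -
  interpret category B by fact
  show ?thesis
    by (rule functsI)
      (simp_all add: on_obj_comp_funct on_arr_comp_funct functsD(1-6)[OF assms(2)]
        functsD(1-6)[OF assms(3)] dom_in_Obj cod_in_Obj ide_in_Arr comp_in_Arr,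
       simp_all add: comp_funct_def)
qed

text \<open>\<open>comp_funct C H G\<close> takes the value \<open>undefined\<close> off the
  carriers of \<open>C\<close>, so \<open>F\<close> has to land in them for both records to
  agree.\<close>

lemma comp_funct_assoc:
  assumes "F \<in> functs B C"
  shows "comp_funct B H (comp_funct B G F) = comp_funct B (comp_funct C H G) F"
  using functsD(1,2)[OF assms] by (auto simp: comp_funct_def compose_def fun_eq_iff)

lemma id_funct_in_functs: "category C \<Longrightarrow> id_funct C \<in> functs C C"
  by (rule functsI) (auto simp: id_funct_def category.dom_in_Obj category.cod_in_Obj
      category.ide_in_Arr category.comp_in_Arr)

lemma comp_id_funct_left:
  assumes "F \<in> functs C D"
  shows "comp_funct C (id_funct D) F = F"
proof -
  have "compose (Obj C) (\<lambda>a\<in>Obj D. a) (on_obj F) = on_obj F"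
    using functsD(1,7)[OF assms] by (auto simp: compose_def fun_eq_iff extensional_def)
  moreover have "compose (Arr C) (\<lambda>a\<in>Arr D. a) (on_arr F) = on_arr F"
    using functsD(2,8)[OF assms] by (auto simp: compose_def fun_eq_iff extensional_def)
  ultimately show ?thesis
    by (simp add: comp_funct_def id_funct_def)
qed

lemma comp_id_funct_right:
  assumes "F \<in> functs C D"
  shows "comp_funct C F (id_funct C) = F"
proof -
  have "compose (Obj C) (on_obj F) (\<lambda>a\<in>Obj C. a) = on_obj F"
    using functsD(7)[OF assms] by (auto simp: compose_def fun_eq_iff extensional_def)
  moreover have "compose (Arr C) (on_arr F) (\<lambda>a\<in>Arr C. a) = on_arr F"
    using functsD(8)[OF assms] by (auto simp: compose_def fun_eq_iff extensional_def)
  ultimately show ?thesis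
    by (simp add: comp_funct_def id_funct_def)
qed

lemma slice_objD:
  "P \<in> slice_obj X \<Longrightarrow> category (tot P)"
  "P \<in> slice_obj X \<Longrightarrow> proj P \<in> functs (tot P) X"
  by (auto simp: slice_obj_def)

lemma slice_homD:
  assumes "F \<in> slice_hom P Q"
  shows "F \<in> functs (tot P) (tot Q)"
    and "comp_funct (tot P) (proj Q) F = proj P"
    and "a \<in> Obj (tot P) \<Longrightarrow> on_obj (proj Q) (on_obj F a) = on_obj (proj P) a"
    and "f \<in> Arr (tot P) \<Longrightarrow> on_arr (proj Q) (on_arr F f) = on_arr (proj P) f"
proof -
  show 1: "F \<in> functs (tot P) (tot Q)" and 2: "comp_funct (tot P) (proj Q) F = proj P"
    using assms by (auto simp: slice_hom_def)
  show "a \<in> Obj (tot P) \<Longrightarrow> on_obj (proj Q) (on_obj F a) = on_obj (proj P) a"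
    by (simp flip: 2 add: on_obj_comp_funct)
  show "f \<in> Arr (tot P) \<Longrightarrow> on_arr (proj Q) (on_arr F f) = on_arr (proj P) f"
    by (simp flip: 2 add: on_arr_comp_funct)
qed

lemma comp_funct_in_slice_hom:
  assumes "category (tot P)" "F \<in> slice_hom P Q" "G \<in> slice_hom Q R"
  shows "comp_funct (tot P) G F \<in> slice_hom P R"
  using assms slice_homD(1,2)[OF assms(2)] slice_homD(1,2)[OF assms(3)]
  by (auto simp: slice_hom_def comp_funct_in_functs comp_funct_assoc)

lemma id_funct_in_slice_hom:
  assumes "P \<in> slice_obj X"
  shows "id_funct (tot P) \<in> slice_hom P P"
  using slice_objD[OF assms] by (simp add: slice_hom_def id_funct_in_functs comp_id_funct_right)

section \<open>Connected components and the tensor\<close>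

text \<open>Reflexive transitive closure relates every element of the type to itself, so the
  equivalence is on \<open>UNIV\<close> and classes can be compared without membership side
  conditions.\<close>

lemma equiv_conn_rel: "equiv UNIV (conn_rel C)"
  by (simp add: conn_rel_def Let_def equiv_def refl_rtrancl trans_rtrancl sym_rtrancl sym_Un_converse)

lemma arr_conn_rel: "f \<in> Arr C \<Longrightarrow> (Dom C f, Cod C f) \<in> conn_rel C"
  unfolding conn_rel_def Let_def by blast

lemma conn_rel_sym: "(a, b) \<in> conn_rel C \<Longrightarrow> (b, a) \<in> conn_rel C"
  using equiv_conn_rel by (metis equivE symE)

lemma conn_rel_trans: "\<lbrakk>(a, b) \<in> conn_rel C; (b, c) \<in> conn_rel C\<rbrakk> \<Longrightarrow> (a, c) \<in> conn_rel C"
  using equiv_conn_rel by (metis equivE transE)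

lemma conn_rel_refl: "(a, a) \<in> conn_rel C"
  using equiv_conn_rel by (metis equivE reflD UNIV_I)

lemma conn_rel_Image_eq_iff:
  "conn_rel C `` {a} = conn_rel C `` {b} \<longleftrightarrow> (a, b) \<in> conn_rel C"
  by (rule eq_equiv_class_iff[OF equiv_conn_rel UNIV_I UNIV_I])

text \<open>Induction along a zigzag of arrows. It later shows that the inverse of the tensor map is
  well defined on components.\<close>

lemma conn_rel_invariant:
  assumes "(a, b) \<in> conn_rel C"
    and "\<And>f. f \<in> Arr C \<Longrightarrow> \<phi> (Dom C f) = \<phi> (Cod C f)"
  shows "\<phi> a = \<phi> b"
  using assms(1) unfolding conn_rel_def Let_def
  by (induction rule: rtrancl_induct) (use assms(2) in auto)

lemma conn_rel_map:
  assumes "(a, b) \<in> conn_rel C"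
    and "\<And>f. f \<in> Arr C \<Longrightarrow> (m (Dom C f), m (Cod C f)) \<in> conn_rel D"
  shows "(m a, m b) \<in> conn_rel D"
proof -
  \<comment> \<open>The invariant here is the component of the image, which agrees at both ends of
    each arrow.\<close>
  have "conn_rel D `` {m a} = conn_rel D `` {m b}"
    by (rule conn_rel_invariant[OF assms(1)]) (simp add: conn_rel_Image_eq_iff assms(2))
  then show ?thesis
    by (simp add: conn_rel_Image_eq_iff)
qed

section \<open>Products in the slice and the functoriality of the tensor\<close>

lemma slice_prod_simps:
  "Obj (tot (slice_prod P Q)) =
    {(p, q). p \<in> Obj (tot P) \<and> q \<in> Obj (tot Q) \<and> on_obj (proj P) p = on_obj (proj Q) q}"
  "Arr (tot (slice_prod P Q)) =
    {(f, g). f \<in> Arr (tot P) \<and> g \<in> Arr (tot Q) \<and> on_arr (proj P) f = on_arr (proj Q) g}"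
  "Dom (tot (slice_prod P Q)) = map_prod (Dom (tot P)) (Dom (tot Q))"
  "Cod (tot (slice_prod P Q)) = map_prod (Cod (tot P)) (Cod (tot Q))"
  by (simp_all add: slice_prod_def Let_def)

lemma slice_prod_conn_relI:
  assumes "f \<in> Arr (tot P)" "g \<in> Arr (tot Q)" "on_arr (proj P) f = on_arr (proj Q) g"
  shows "((Dom (tot P) f, Dom (tot Q) g), (Cod (tot P) f, Cod (tot Q) g))
    \<in> conn_rel (tot (slice_prod P Q))"
  using arr_conn_rel[of "(f, g)" "tot (slice_prod P Q)"] assms by (simp add: slice_prod_simps)

text \<open>A pair of slice morphisms carries zigzags to zigzags, so the image of a component lies
  in a single component, and saturating it gives the class of the image of any
  representative.\<close>

lemma ten_map_class:
  assumes F: "F \<in> slice_hom P P'" and G: "G \<in> slice_hom Q Q'"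
  shows "ten_map P' Q' F G (conn_rel (tot (slice_prod P Q)) `` {c})
    = conn_rel (tot (slice_prod P' Q')) `` {map_prod (on_obj F) (on_obj G) c}"
proof -
  let ?C = "tot (slice_prod P Q)" and ?D = "tot (slice_prod P' Q')"
  let ?m = "map_prod (on_obj F) (on_obj G)"
  have m: "(?m a, ?m b) \<in> conn_rel ?D" if "(a, b) \<in> conn_rel ?C" for a b
  proof (rule conn_rel_map[OF that])
    fix h assume "h \<in> Arr ?C"
    then obtain f g where h: "h = (f, g)" "f \<in> Arr (tot P)" "g \<in> Arr (tot Q)"
      "on_arr (proj P) f = on_arr (proj Q) g"
      by (auto simp: slice_prod_simps)
    show "(?m (Dom ?C h), ?m (Cod ?C h)) \<in> conn_rel ?D"
      using slice_prod_conn_relI[of "on_arr F f" P' "on_arr G g" Q'] h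
        functsD(2,3,4)[OF slice_homD(1)[OF F]] functsD(2,3,4)[OF slice_homD(1)[OF G]]
        slice_homD(4)[OF F] slice_homD(4)[OF G]
      by (simp add: slice_prod_simps)
  qed
  show ?thesis
    unfolding ten_map_def
  proof (intro equalityI subsetI)
    fix y assume "y \<in> conn_rel ?D `` (?m ` (conn_rel ?C `` {c}))"
    then obtain x where "(c, x) \<in> conn_rel ?C" "(?m x, y) \<in> conn_rel ?D" by auto
    then show "y \<in> conn_rel ?D `` {?m c}"
      using m conn_rel_trans by (metis Image_singleton_iff)
  next
    fix y assume "y \<in> conn_rel ?D `` {?m c}"
    then show "y \<in> conn_rel ?D `` (?m ` (conn_rel ?C `` {c}))"
      using conn_rel_refl[of c ?C] by blast
  qed
qed

lemma ten_cases:
  assumes "t \<in> ten P Q"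
  obtains p q where "p \<in> Obj (tot P)" "q \<in> Obj (tot Q)" "on_obj (proj P) p = on_obj (proj Q) q"
    "t = conn_rel (tot (slice_prod P Q)) `` {(p, q)}"
  using assms by (auto simp: ten_def components_def quotient_def slice_prod_simps)

lemma class_in_ten:
  assumes "p \<in> Obj (tot P)" "q \<in> Obj (tot Q)" "on_obj (proj P) p = on_obj (proj Q) q"
  shows "conn_rel (tot (slice_prod P Q)) `` {(p, q)} \<in> ten P Q"
  using assms by (auto simp: ten_def components_def quotient_def slice_prod_simps)

lemma ten_map_comp:
  assumes "category (tot P)" "category (tot Q)"
    and "F \<in> slice_hom P P'" "G \<in> slice_hom Q Q'" "F' \<in> slice_hom P' P''" "G' \<in> slice_hom Q' Q''"
    and "t \<in> ten P Q"
  shows "ten_map P'' Q'' F' G' (ten_map P' Q' F G t)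
    = ten_map P'' Q'' (comp_funct (tot P) F' F) (comp_funct (tot Q) G' G) t"
  using assms(7)
  by (rule ten_cases) (simp add: ten_map_class[OF assms(3,4)] ten_map_class[OF assms(5,6)]
    ten_map_class[OF comp_funct_in_slice_hom[OF assms(1,3,5)] comp_funct_in_slice_hom[OF assms(2,4,6)]]
    on_obj_comp_funct)

section \<open>The category of elements of an action\<close>

text \<open>A copresheaf on \<open>C\<close>, given as one set \<open>E\<close> fibred over the
  objects by \<open>c\<close>, with arrows acting covariantly. The injection \<open>pr\<close> codes
  a pair of starting element and arrow, so that the arrows of the category of elements live in a
  prescribed type.\<close>

locale category_action = category C for C :: "('o, 'a) cat" +
  fixes E :: "'e set" and c :: "'e \<Rightarrow> 'o" and act :: "'e \<Rightarrow> 'a \<Rightarrow> 'e" and pr :: "'e \<times> 'a \<Rightarrow> 'b"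
  assumes c_in: "e \<in> E \<Longrightarrow> c e \<in> Obj C"
    and act_in: "\<lbrakk>e \<in> E; g \<in> Arr C; Dom C g = c e\<rbrakk> \<Longrightarrow> act e g \<in> E"
    and c_act: "\<lbrakk>e \<in> E; g \<in> Arr C; Dom C g = c e\<rbrakk> \<Longrightarrow> c (act e g) = Cod C g"
    and act_ide: "e \<in> E \<Longrightarrow> act e (Ide C (c e)) = e"
    and act_comp: "\<lbrakk>e \<in> E; g \<in> Arr C; Dom C g = c e; h \<in> Arr C; Dom C h = Cod C g\<rbrakk>
      \<Longrightarrow> act e (Comp C h g) = act (act e g) h"
    and pr_inj: "inj pr"
begin

definition elts :: "('e, 'b) cat" where
  "elts = \<lparr>Obj = E,
     Arr = pr ` {(e, g). e \<in> E \<and> g \<in> Arr C \<and> Dom C g = c e},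
     Dom = (\<lambda>a. fst (inv pr a)),
     Cod = (\<lambda>a. act (fst (inv pr a)) (snd (inv pr a))),
     Ide = (\<lambda>e. pr (e, Ide C (c e))),
     Comp = (\<lambda>b a. pr (fst (inv pr a), Comp C (snd (inv pr b)) (snd (inv pr a))))\<rparr>"

definition elts_proj :: "('e, 'b, 'o, 'a) funct" where
  "elts_proj = \<lparr>on_obj = restrict c (Obj elts), on_arr = restrict (snd \<circ> inv pr) (Arr elts)\<rparr>"

lemma inv_pr [simp]: "inv pr (pr x) = x"
  using pr_inj by simp

lemma elts_simps [simp]:
  "Obj elts = E" "Dom elts (pr (e, g)) = e" "Cod elts (pr (e, g)) = act e g"
  "Ide elts e = pr (e, Ide C (c e))" "Comp elts (pr (e', g')) (pr (e, g)) = pr (e, Comp C g' g)"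
  by (simp_all add: elts_def)

lemma pr_in_Arr_iff [simp]: "pr (e, g) \<in> Arr elts \<longleftrightarrow> e \<in> E \<and> g \<in> Arr C \<and> Dom C g = c e"
  using pr_inj by (auto simp: elts_def inj_image_mem_iff)

lemma Arr_elts_cases:
  assumes "a \<in> Arr elts"
  obtains e g where "a = pr (e, g)" "e \<in> E" "g \<in> Arr C" "Dom C g = c e"
  using assms by (auto simp: elts_def)

lemma category_elts: "category elts"
  by unfold_locales
    (auto elim!: Arr_elts_cases simp: c_in act_in c_act act_ide act_comp dom_in_Obj cod_in_Obj
      ide_in_Arr dom_ide cod_ide comp_in_Arr dom_comp cod_comp comp_ide_left comp_assoc,
     metis comp_ide_right)

lemma elts_proj_simps [simp]:
  "e \<in> E \<Longrightarrow> on_obj elts_proj e = c e"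
  "\<lbrakk>e \<in> E; g \<in> Arr C; Dom C g = c e\<rbrakk> \<Longrightarrow> on_arr elts_proj (pr (e, g)) = g"
  by (simp_all add: elts_proj_def)

lemma elts_proj_in_functs: "elts_proj \<in> functs elts C"
proof (rule functsI)
  show "on_obj elts_proj \<in> extensional (Obj elts)" "on_arr elts_proj \<in> extensional (Arr elts)"
    by (simp_all add: elts_proj_def)
qed (auto elim!: Arr_elts_cases simp: c_in act_in c_act ide_in_Arr dom_ide cod_ide comp_in_Arr
    dom_comp cod_comp)

end

text \<open>Discrete opfibrations compose: an arrow of \<open>X\<close> lifts uniquely to some
  \<open>g\<close> of \<open>U\<close> starting at \<open>c e\<close>, and \<open>pr (e, g)\<close>
  is the only arrow of \<open>elts\<close> that starts at \<open>e\<close> and lies over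
  \<open>g\<close>.\<close>

lemma (in category_action) elts_disc_opfib:
  assumes "U \<in> disc_opfibs X" "tot U = C"
  defines "Q \<equiv> \<lparr>tot = elts, proj = comp_funct elts (proj U) elts_proj\<rparr>"
  shows "Q \<in> disc_opfibs X"
proof -
  have U: "proj U \<in> functs C X"
    "\<And>u y. \<lbrakk>u \<in> Obj C; y \<in> Arr X; Dom X y = on_obj (proj U) u\<rbrakk>
      \<Longrightarrow> \<exists>!g. g \<in> Arr C \<and> Dom C g = u \<and> on_arr (proj U) g = y"
    using assms(1,2) by (auto simp: disc_opfibs_def slice_obj_def)
  have "Q \<in> slice_obj X"
    unfolding Q_def slice_obj_def
    using category_elts comp_funct_in_functs elts_proj_in_functs U(1) by auto
  moreover have "\<exists>!g. g \<in> Arr elts \<and> Dom elts g = e \<and> on_arr (proj Q) g = y"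
    if e: "e \<in> E" and y: "y \<in> Arr X" "Dom X y = on_obj (proj Q) e" for e y
  proof -
    have "Dom X y = on_obj (proj U) (c e)"
      using e y by (simp add: Q_def on_obj_comp_funct)
    then obtain g where g: "g \<in> Arr C" "Dom C g = c e" "on_arr (proj U) g = y"
      and g_unique: "\<And>g'. \<lbrakk>g' \<in> Arr C; Dom C g' = c e; on_arr (proj U) g' = y\<rbrakk> \<Longrightarrow> g' = g"
      using U(2)[OF c_in[OF e] y(1)] by blast
    show ?thesis
    proof (rule ex1I[of _ "pr (e, g)"])
      show "pr (e, g) \<in> Arr elts \<and> Dom elts (pr (e, g)) = e \<and> on_arr (proj Q) (pr (e, g)) = y"
        using e g by (simp add: Q_def on_arr_comp_funct)
    next
      fix a assume a: "a \<in> Arr elts \<and> Dom elts a = e \<and> on_arr (proj Q) a = y"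
      then obtain g' where g': "a = pr (e, g')" "g' \<in> Arr C" "Dom C g' = c e"
        by (auto elim!: Arr_elts_cases)
      moreover have "on_arr (proj U) g' = y"
        using a e g' by (simp add: Q_def on_arr_comp_funct)
      ultimately show "a = pr (e, g)"
        using g_unique by blast
    qed
  qed
  ultimately show ?thesis
    by (simp add: disc_opfibs_def Q_def)
qed

section \<open>The unit of the reflection is initial\<close>

text \<open>\<open>comma_obj\<close> collects the objects of all comma categories \<open>eta / u\<close>, and \<open>comma_rel\<close> is
  the relation of lying in the same component of one of them.\<close>

definition comma_obj ::
  "('o1, 'a1) cat \<Rightarrow> ('o2, 'a2) cat \<Rightarrow> ('o1, 'a1, 'o2, 'a2) funct \<Rightarrow> ('o1 \<times> 'a2) set" where
  "comma_obj C D F = {(p, f). p \<in> Obj C \<and> f \<in> Arr D \<and> Dom D f = on_obj F p}"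

text \<open>A step is an arrow \<open>h\<close> of the comma category over \<open>Cod D f\<close>,
  from \<open>f\<close> precomposed with \<open>F h\<close> to \<open>f\<close>. The object of
  \<open>D\<close> is not recorded, since the codomain of the second component determines
  it.\<close>

definition comma_step ::
  "('o1, 'a1) cat \<Rightarrow> ('o2, 'a2) cat \<Rightarrow> ('o1, 'a1, 'o2, 'a2) funct
    \<Rightarrow> (('o1 \<times> 'a2) \<times> ('o1 \<times> 'a2)) set" where
  "comma_step C D F = {((Dom C h, Comp D f (on_arr F h)), (Cod C h, f)) | h f.
     h \<in> Arr C \<and> f \<in> Arr D \<and> Dom D f = on_obj F (Cod C h)}"

definition comma_rel ::
  "('o1, 'a1) cat \<Rightarrow> ('o2, 'a2) cat \<Rightarrow> ('o1, 'a1, 'o2, 'a2) funct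
    \<Rightarrow> (('o1 \<times> 'a2) \<times> ('o1 \<times> 'a2)) set" where
  "comma_rel C D F = (comma_step C D F \<union> (comma_step C D F)\<inverse>)\<^sup>*"

definition initial_funct ::
  "('o1, 'a1) cat \<Rightarrow> ('o2, 'a2) cat \<Rightarrow> ('o1, 'a1, 'o2, 'a2) funct \<Rightarrow> bool" where
  "initial_funct C D F \<longleftrightarrow>
     (\<forall>u\<in>Obj D. \<exists>p f. (p, f) \<in> comma_obj C D F \<and> Cod D f = u) \<and>
     (\<forall>p f p' f'. (p, f) \<in> comma_obj C D F \<longrightarrow> (p', f') \<in> comma_obj C D F \<longrightarrow>
        Cod D f = Cod D f' \<longrightarrow> ((p, f), (p', f')) \<in> comma_rel C D F)"

section \<open>Components of comma categories and their transport along arrows\<close>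

lemma equiv_comma_rel: "equiv UNIV (comma_rel C D F)"
  by (simp add: comma_rel_def equiv_def refl_rtrancl trans_rtrancl sym_rtrancl sym_Un_converse)

lemma comma_rel_induct [consumes 1, case_names refl step]:
  assumes "(s, t) \<in> comma_rel C D F"
    and "\<And>s. R s s"
    and "\<And>s t t'. \<lbrakk>(t, t') \<in> comma_step C D F \<or> (t', t) \<in> comma_step C D F; R s t\<rbrakk> \<Longrightarrow> R s t'"
  shows "R s t"
  using assms(1) unfolding comma_rel_def
  by (induction rule: rtrancl_induct) (use assms(2,3) in auto)

text \<open>Precomposition does not change codomains, so a zigzag stays inside one comma
  category.\<close>

lemma comma_rel_Cod:
  assumes "category D" "F \<in> functs C D" "((p, f), (p', f')) \<in> comma_rel C D F"
  shows "Cod D f = Cod D f'"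
proof -
  interpret D: category D by fact
  have "Cod D (snd s) = Cod D (snd t)" if "(s, t) \<in> comma_rel C D F" for s t
    using that
    by (induction rule: comma_rel_induct)
      (use functsD(2,4)[OF assms(2)] in \<open>auto simp: comma_step_def D.cod_comp\<close>)
  from this[OF assms(3)] show ?thesis by simp
qed

text \<open>Postcomposition with \<open>g\<close> is a functor between comma categories, hence acts
  on their components. This is the action that makes the components into a copresheaf on
  \<open>D\<close>.\<close>

lemma comma_rel_post:
  fixes C :: "('o1, 'a1) cat" and D :: "('o2, 'a2) cat"
  assumes "category D" "F \<in> functs C D" "((p, f), (p', f')) \<in> comma_rel C D F"
    and "g \<in> Arr D" "Dom D g = Cod D f"
  shows "((p, Comp D g f), (p', Comp D g f')) \<in> comma_rel C D F"
proof -
  interpret D: category D by fact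
  note F = functsD[OF assms(2)]
  define post where "post s = (fst s, Comp D g (snd s))" for s :: "'o1 \<times> 'a2"
  have step_post: "(post s, post t) \<in> comma_step C D F"
    if "(s, t) \<in> comma_step C D F" "Dom D g = Cod D (snd t)" for s t
    using that assms(4) F(2,3,4) unfolding comma_step_def post_def
    by (auto simp: D.comp_assoc D.comp_in_Arr D.dom_comp)
  have cod: "Cod D (snd s) = Cod D (snd t)" if "(s, t) \<in> comma_step C D F" for s t
    using that F(2,4) by (auto simp: comma_step_def D.cod_comp)
  \<comment> \<open>The equality of codomains is carried through the induction so that
    \<open>g\<close> remains composable at every vertex of the zigzag.\<close>
  have "Dom D g = Cod D (snd s) \<longrightarrow> Cod D (snd s) = Cod D (snd t) \<and>
      (post s, post t) \<in> comma_rel C D F"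
    if "(s, t) \<in> comma_rel C D F" for s t
    using that
  proof (induction rule: comma_rel_induct)
    case (refl s)
    then show ?case by (simp add: comma_rel_def)
  next
    case (step s t t')
    show ?case
    proof
      assume g: "Dom D g = Cod D (snd s)"
      with step have st: "Cod D (snd s) = Cod D (snd t)"
        "(post s, post t) \<in> comma_rel C D F"
        by auto
      have tt': "Cod D (snd t) = Cod D (snd t')"
        using step(1) cod by metis
      have "(post t, post t')
          \<in> comma_step C D F \<union> (comma_step C D F)\<inverse>"
        using step(1) step_post[of t t'] step_post[of t' t] g st(1) tt' by auto
      with st show "Cod D (snd s) = Cod D (snd t') \<and>
          (post s, post t') \<in> comma_rel C D F"
        using tt' unfolding comma_rel_def by (metis rtrancl.rtrancl_into_rtrancl)
    qed
  qed
  from this[OF assms(3)] show ?thesis using assms(5) by (simp add: post_def)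
qed

section \<open>Coding pairs and quotients inside an infinite universe\<close>

lemma ex_inj_pair:
  assumes "infinite (UNIV :: 'u set)"
  shows "\<exists>pr :: 'u \<times> 'u \<Rightarrow> 'u. inj pr"
proof -
  obtain pr :: "'u \<times> 'u \<Rightarrow> 'u" where "bij_betw pr (UNIV \<times> UNIV) UNIV"
    using card_of_Times_same_infinite[OF assms] unfolding card_of_ordIso[symmetric] by blast
  then show ?thesis
    by (auto simp: bij_betw_def)
qed

text \<open>The quotient by \<open>R\<close> is realised inside \<open>'u\<close> by coding one
  chosen member of each class.\<close>

lemma ex_class_map:
  assumes "inj (pr :: 't \<Rightarrow> 'u)" "equiv UNIV R"
  shows "\<exists>rep :: 't \<Rightarrow> 'u. \<forall>s t. rep s = rep t \<longleftrightarrow> (s, t) \<in> R"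
proof (intro exI allI iffI)
  fix s t
  have some: "(s, SOME t. (s, t) \<in> R) \<in> R" for s
    using someI[of "\<lambda>t. (s, t) \<in> R" s] assms(2) by (simp add: equiv_def refl_on_def)
  \<comment> \<open>This goal fixes the witness left open by \<open>exI\<close>:
    \<open>rep s\<close> is the code of a chosen element related to \<open>s\<close>.\<close>
  show "(s, t) \<in> R" if "pr (SOME t. (s, t) \<in> R) = pr (SOME s. (t, s) \<in> R)"
    using injD[OF assms(1) that] some[of s] some[of t] assms(2)
    by (metis equivE symD transD)
  show "pr (SOME t. (s, t) \<in> R) = pr (SOME s. (t, s) \<in> R)" if "(s, t) \<in> R"
  proof -
    have "(s, x) \<in> R \<longleftrightarrow> (t, x) \<in> R" for x
      using that assms(2) by (metis equivE symD transD)
    then show ?thesis by simp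
  qed
qed

text \<open>The universal property can only be tested on opfibrations with carriers in
  \<open>'u\<close>, so the opfibration of components has to be coded there; infinity of
  \<open>'u\<close> makes this possible.\<close>

lemma unit_initial:
  fixes X :: "('u, 'u) cat" and P U :: "('u, 'u, 'u, 'u) over"
  assumes inf: "infinite (UNIV :: 'u set)"
    and P: "P \<in> slice_obj X" and U: "U \<in> disc_opfibs X" and eta: "eta \<in> slice_hom P U"
    and univ: "\<And>(Q :: ('u, 'u, 'u, 'u) over) F. \<lbrakk>Q \<in> disc_opfibs X; F \<in> slice_hom P Q\<rbrakk>
      \<Longrightarrow> \<exists>!G. G \<in> slice_hom U Q \<and> comp_funct (tot P) G eta = F"
  shows "initial_funct (tot P) (tot U) eta"
proof -
  let ?P = "tot P" and ?U = "tot U"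
  let ?T = "comma_obj ?P ?U eta" and ?R = "comma_rel ?P ?U eta"
  have U': "U \<in> slice_obj X"
    using U by (simp add: disc_opfibs_def)
  interpret P: category ?P using P by (rule slice_objD)
  interpret U: category ?U using U' by (rule slice_objD)
  note eta_f = slice_homD(1)[OF eta]
  note eta_s = functsD[OF eta_f]
  obtain pr :: "'u \<times> 'u \<Rightarrow> 'u" where pr: "inj pr"
    using ex_inj_pair[OF inf] by blast
  obtain rep :: "'u \<times> 'u \<Rightarrow> 'u" where rep: "\<And>s t. rep s = rep t \<longleftrightarrow> (s, t) \<in> ?R"
    using ex_class_map[OF pr equiv_comma_rel] by metis
  \<comment> \<open>\<open>sec\<close> picks a comma object in a named component. \<open>c\<close>
    and \<open>act\<close> are computed on it, and \<open>c_rep\<close> and \<open>act_rep\<close>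
    show that the choice is immaterial.\<close>
  define sec where "sec = inv_into ?T rep"
  define c where "c e = Cod ?U (snd (sec e))" for e
  define act where "act e g = rep (fst (sec e), Comp ?U g (snd (sec e)))" for e g
  have sec: "sec (rep t) \<in> ?T" "(sec (rep t), t) \<in> ?R" if "t \<in> ?T" for t
    using that rep[of "sec (rep t)" t] unfolding sec_def by (simp_all add: inv_into_into f_inv_into_f)
  have c_rep: "c (rep (p, f)) = Cod ?U f" if "(p, f) \<in> ?T" for p f
    unfolding c_def using comma_rel_Cod[OF U.category_axioms eta_f] sec(2)[OF that]
    by (metis prod.collapse)
  have act_rep: "act (rep (p, f)) g = rep (p, Comp ?U g f)"
    if "(p, f) \<in> ?T" "g \<in> Arr ?U" "Dom ?U g = Cod ?U f" for p f g
    unfolding act_def rep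
    using comma_rel_post[OF U.category_axioms eta_f, of "fst (sec (rep (p, f)))"
        "snd (sec (rep (p, f)))" p f g] sec(2)[OF that(1)] c_rep[OF that(1)] that(2,3)
    by (simp add: c_def)
  have T_comp: "(p, Comp ?U g f) \<in> ?T"
    if "(p, f) \<in> ?T" "g \<in> Arr ?U" "Dom ?U g = Cod ?U f" for p f g
    using that by (auto simp: comma_obj_def U.comp_in_Arr U.dom_comp)
  interpret E: category_action ?U "rep ` ?T" c act pr
  proof
    fix e assume "e \<in> rep ` ?T"
    then obtain p f where e: "e = rep (p, f)" and T: "(p, f) \<in> ?T" by auto
    then have f: "f \<in> Arr ?U" by (simp add: comma_obj_def)
    show "c e \<in> Obj ?U"
      using e T f by (simp add: c_rep U.cod_in_Obj)
    show "act e (Ide ?U (c e)) = e"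
      using e T f by (simp add: c_rep act_rep U.ide_in_Arr U.cod_in_Obj U.dom_ide U.comp_ide_left)
    fix g assume g: "g \<in> Arr ?U" "Dom ?U g = c e"
    show "act e g \<in> rep ` ?T" "c (act e g) = Cod ?U g"
      using e T f g by (auto simp: c_rep act_rep T_comp U.cod_comp)
    fix h assume h: "h \<in> Arr ?U" "Dom ?U h = Cod ?U g"
    show "act e (Comp ?U h g) = act (act e g) h"
      using e T f g h
      by (simp add: c_rep act_rep T_comp U.cod_comp U.comp_in_Arr U.dom_comp U.comp_assoc)
  qed (rule pr)
  define Q where "Q = \<lparr>tot = E.elts, proj = comp_funct E.elts (proj U) E.elts_proj\<rparr>"
  have Q: "Q \<in> disc_opfibs X"
    unfolding Q_def using E.elts_disc_opfib U by blast
  have K: "E.elts_proj \<in> slice_hom Q U"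
    by (simp add: Q_def slice_hom_def E.elts_proj_in_functs)
  \<comment> \<open>\<open>base p\<close> is the component of the identity of \<open>eta p\<close>;
    it lies over \<open>eta p\<close>, so it gives a lift of \<open>eta\<close> through the
    projection.\<close>
  define base where "base p = rep (p, Ide ?U (on_obj eta p))" for p
  define lift where "lift = \<lparr>on_obj = restrict base (Obj ?P),
    on_arr = (\<lambda>h\<in>Arr ?P. pr (base (Dom ?P h), on_arr eta h))\<rparr>"
  have idT: "(p, Ide ?U (on_obj eta p)) \<in> ?T" if "p \<in> Obj ?P" for p
    using that eta_s(1) by (simp add: comma_obj_def U.ide_in_Arr U.dom_ide)
  have base: "base p \<in> rep ` ?T" "c (base p) = on_obj eta p" if "p \<in> Obj ?P" for p
    using that idT eta_s(1) by (auto simp: base_def c_rep U.cod_ide)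
  have act_base: "act (base p) g = rep (p, g)" if "(p, g) \<in> ?T" for p g
  proof -
    have "p \<in> Obj ?P" "g \<in> Arr ?U" "Dom ?U g = on_obj eta p"
      using that by (auto simp: comma_obj_def)
    then show ?thesis
      using idT eta_s(1) U.comp_ide_right[of g] by (simp add: base_def act_rep U.cod_ide)
  qed
  have act_eta: "act (base (Dom ?P h)) (on_arr eta h) = base (Cod ?P h)" if h: "h \<in> Arr ?P" for h
  proof -
    have cod: "Ide ?U (on_obj eta (Cod ?P h)) \<in> Arr ?U"
      "Dom ?U (Ide ?U (on_obj eta (Cod ?P h))) = on_obj eta (Cod ?P h)"
      "Comp ?U (Ide ?U (on_obj eta (Cod ?P h))) (on_arr eta h) = on_arr eta h"
      using h eta_s(1,2,4) U.comp_ide_left[of "on_arr eta h"]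
      by (auto simp: U.ide_in_Arr U.dom_ide P.cod_in_Obj)
    \<comment> \<open>The arrow \<open>h\<close> itself is a comma arrow from \<open>eta h\<close>
      to the identity at its codomain, so both lie in the same component.\<close>
    then have "((Dom ?P h, on_arr eta h), (Cod ?P h, Ide ?U (on_obj eta (Cod ?P h))))
        \<in> comma_step ?P ?U eta"
      using h unfolding comma_step_def by fastforce
    then have "rep (Dom ?P h, on_arr eta h) = base (Cod ?P h)"
      unfolding base_def rep comma_rel_def by blast
    moreover have "(Dom ?P h, on_arr eta h) \<in> ?T"
      using h eta_s(2,3) by (simp add: comma_obj_def P.dom_in_Obj)
    ultimately show ?thesis by (simp add: act_base)
  qed
  have lift_functs: "lift \<in> functs ?P E.elts"
  proof (rule functsI)
    show "on_obj lift \<in> extensional (Obj ?P)" "on_arr lift \<in> extensional (Arr ?P)"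
      by (simp_all add: lift_def)
  qed (use eta_s base act_eta in \<open>auto simp: lift_def P.dom_in_Obj P.cod_in_Obj P.ide_in_Arr
      P.dom_ide P.comp_in_Arr P.dom_comp\<close>)
  have K_lift: "comp_funct ?P E.elts_proj lift = eta"
  proof -
    have "on_obj (comp_funct ?P E.elts_proj lift) = on_obj eta"
      by (rule extensionalityI[of _ "Obj ?P"])
        (use eta_s(7) base in \<open>auto simp: on_obj_comp_funct lift_def\<close>, simp add: comp_funct_def)
    moreover have "on_arr (comp_funct ?P E.elts_proj lift) = on_arr eta"
      by (rule extensionalityI[of _ "Arr ?P"])
        (use eta_s(2,3,8) base in \<open>auto simp: on_arr_comp_funct lift_def P.dom_in_Obj\<close>,
          simp add: comp_funct_def)
    ultimately show ?thesis by simp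
  qed
  have "comp_funct ?P (comp_funct E.elts (proj U) E.elts_proj) lift = proj P"
    using K_lift comp_funct_assoc[OF lift_functs] slice_homD(2)[OF eta] by metis
  then have "lift \<in> slice_hom P Q"
    using lift_functs by (simp add: slice_hom_def Q_def)
  then obtain G where G: "G \<in> slice_hom U Q" "comp_funct ?P G eta = lift"
    using univ[OF Q] by blast
  note G_s = functsD[OF slice_homD(1)[OF G(1)]]
  \<comment> \<open>The projection after \<open>G\<close> and the identity are both endomorphisms of
    \<open>U\<close> extending \<open>eta\<close>, so uniqueness in the universal property
    identifies them.\<close>
  have "comp_funct ?P (comp_funct ?U E.elts_proj G) eta = eta"
    using K_lift G(2) comp_funct_assoc[OF eta_f] by metis
  moreover have "comp_funct ?U E.elts_proj G \<in> slice_hom U U"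
    using comp_funct_in_slice_hom[OF U.category_axioms G(1) K] .
  moreover have "comp_funct ?P (id_funct ?U) eta = eta"
    by (rule comp_id_funct_left[OF eta_f])
  ultimately have KG: "comp_funct ?U E.elts_proj G = id_funct ?U"
    using univ[OF U eta] id_funct_in_slice_hom[OF U'] by blast
  have KG_obj: "c (on_obj G u) = u" if "u \<in> Obj ?U" for u
    using that G_s(1) on_obj_comp_funct[of u ?U E.elts_proj G]
    by (simp add: KG id_funct_def Q_def)
  \<comment> \<open>\<open>G f\<close> starts at \<open>G (eta p) = base p\<close> and lies over
    \<open>f\<close>, so it is the arrow \<open>pr (base p, f)\<close>, whose codomain is the
    pushforward of \<open>base p\<close> along \<open>f\<close>.\<close>
  have G_rep: "on_obj G (Cod ?U f) = rep (p, f)" if T: "(p, f) \<in> ?T" for p f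
  proof -
    have f: "p \<in> Obj ?P" "f \<in> Arr ?U" "Dom ?U f = on_obj eta p"
      using T by (auto simp: comma_obj_def)
    obtain e g where eg: "on_arr G f = pr (e, g)" "e \<in> rep ` ?T" "g \<in> Arr ?U" "Dom ?U g = c e"
      using G_s(2)[OF f(2)] by (auto simp: Q_def elim!: E.Arr_elts_cases)
    have "g = f"
      using on_arr_comp_funct[OF f(2), of E.elts_proj G] eg f(2) by (simp add: KG id_funct_def)
    moreover have "e = base p"
      using G_s(3)[OF f(2)] eg(1) f on_obj_comp_funct[OF f(1), of G eta]
      by (simp add: Q_def G(2) lift_def)
    ultimately show ?thesis
      using G_s(4)[OF f(2)] eg(1) act_base[OF T] by (simp add: Q_def)
  qed
  show ?thesis
    unfolding initial_funct_def
  proof (intro conjI ballI allI impI)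
    fix u assume u: "u \<in> Obj ?U"
    then obtain p f where T: "(p, f) \<in> ?T" "on_obj G u = rep (p, f)"
      using G_s(1)[OF u] by (auto simp: Q_def)
    then have "Cod ?U f = u"
      using KG_obj[OF u] c_rep by simp
    with T show "\<exists>p f. (p, f) \<in> ?T \<and> Cod ?U f = u" by blast
  next
    fix p f p' f'
    assume "(p, f) \<in> ?T" "(p', f') \<in> ?T" "Cod ?U f = Cod ?U f'"
    then show "((p, f), (p', f')) \<in> ?R"
      using G_rep rep by metis
  qed
qed

section \<open>Initial functors induce bijections of tensors\<close>

text \<open>\<open>ten P A\<close> is the colimit, over the opposite of \<open>P\<close>, of the
  presheaf that \<open>A\<close> induces on \<open>P\<close>. The opposite of an initial functor is
  final, and restriction along a final functor preserves colimits; the proof is the elementary form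
  of this.\<close>

lemma bij_betw_ten_map_initial:
  assumes P: "P \<in> slice_obj X" and U: "U \<in> slice_obj X" and A: "A \<in> disc_fibs X"
    and eta: "eta \<in> slice_hom P U" and init: "initial_funct (tot P) (tot U) eta"
  shows "bij_betw (ten_map U A eta (id_funct (tot A))) (ten P A) (ten U A)"
proof -
  let ?P = "tot P" and ?U = "tot U" and ?A = "tot A"
  let ?T = "comma_obj ?P ?U eta" and ?R = "comma_rel ?P ?U eta"
  let ?C = "tot (slice_prod P A)" and ?D = "tot (slice_prod U A)"
  have A': "A \<in> slice_obj X"
    using A by (simp add: disc_fibs_def)
  interpret P: category ?P using P by (rule slice_objD)
  interpret U: category ?U using U by (rule slice_objD)
  interpret A: category ?A using A' by (rule slice_objD)
  note P_s = functsD[OF slice_objD(2)[OF P]]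
  note U_s = functsD[OF slice_objD(2)[OF U]]
  note A_s = functsD[OF slice_objD(2)[OF A']]
  note eta_s = functsD[OF slice_homD(1)[OF eta]]
  note eta_X = slice_homD(3,4)[OF eta]
  have lift_ex: "\<exists>k. k \<in> Arr ?A \<and> Cod ?A k = a \<and> on_arr (proj A) k = y"
    if "a \<in> Obj ?A" "y \<in> Arr X" "Cod X y = on_obj (proj A) a" for a y
    using A that unfolding disc_fibs_def by blast
  have lift_unique: "k = k'"
    if "k \<in> Arr ?A" "k' \<in> Arr ?A" "Cod ?A k = Cod ?A k'" "on_arr (proj A) k = on_arr (proj A) k'"
    for k k'
  proof -
    have "\<exists>!g. g \<in> Arr ?A \<and> Cod ?A g = Cod ?A k \<and> on_arr (proj A) g = on_arr (proj A) k"
      using A that A_s(2,4) A.cod_in_Obj by (simp add: disc_fibs_def)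
    with that show ?thesis by metis
  qed
  \<comment> \<open>For \<open>d = (u, a)\<close>, \<open>S d\<close> collects all candidates
    \<open>(p, b)\<close> for the inverse image: \<open>b\<close> is the pullback of
    \<open>a\<close> along some \<open>f : eta p \<rightarrow> u\<close>.\<close>
  define S where "S d = {(p, Dom ?A k) | p f k. (p, f) \<in> ?T \<and> Cod ?U f = fst d \<and>
    k \<in> Arr ?A \<and> Cod ?A k = snd d \<and> on_arr (proj A) k = on_arr (proj U) f}" for d
  have S_I: "(p, b) \<in> S (u, a)"
    if "(p, f) \<in> ?T" "Cod ?U f = u" "k \<in> Arr ?A" "Cod ?A k = a" "Dom ?A k = b"
      "on_arr (proj A) k = on_arr (proj U) f" for p f k u a b
    using that by (auto simp: S_def)
  \<comment> \<open>Lift \<open>h\<close> to an arrow \<open>l\<close> ending at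
    \<open>Dom k'\<close>. The composite of \<open>k'\<close> after \<open>l\<close> lies over
    \<open>f\<close> and ends where \<open>k\<close> does, so it equals \<open>k\<close> by
    uniqueness of lifts; hence \<open>(h, l)\<close> joins the two pairs.\<close>
  have comma_step_conn: "((p, Dom ?A k), (p', Dom ?A k')) \<in> conn_rel ?C"
    if st: "((p, f), (p', f')) \<in> comma_step ?P ?U eta"
      and k: "k \<in> Arr ?A" "on_arr (proj A) k = on_arr (proj U) f"
      and k': "k' \<in> Arr ?A" "on_arr (proj A) k' = on_arr (proj U) f'"
      and kk': "Cod ?A k = Cod ?A k'" for p f p' f' k k'
  proof -
    obtain h where h: "h \<in> Arr ?P" "p = Dom ?P h" "p' = Cod ?P h" "f = Comp ?U f' (on_arr eta h)"
      and f': "f' \<in> Arr ?U" "Dom ?U f' = on_obj eta (Cod ?P h)"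
      using st by (auto simp: comma_step_def)
    have "Cod X (on_arr (proj P) h) = on_obj (proj A) (Dom ?A k')"
      using P_s(4)[OF h(1)] A_s(3)[OF k'(1)] U_s(3)[OF f'(1)] k' f' eta_X(1) h(1) P.cod_in_Obj
      by metis
    then obtain l where l: "l \<in> Arr ?A" "Cod ?A l = Dom ?A k'"
        "on_arr (proj A) l = on_arr (proj P) h"
      using lift_ex[OF A.dom_in_Obj[OF k'(1)] P_s(2)[OF h(1)]] by blast
    have "on_arr (proj A) (Comp ?A k' l) = on_arr (proj U) f"
      using A_s(6)[OF l(1) k'(1)] l k' h(4) f' eta_X(2)[OF h(1)] eta_s(2,4)[OF h(1)]
        U_s(6)[of "on_arr eta h" f'] by simp
    then have "k = Comp ?A k' l"
      using lift_unique[OF k(1) A.comp_in_Arr[OF l(1) k'(1)]] l k k' kk' by (simp add: A.cod_comp)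
    then have "Dom ?A k = Dom ?A l"
      using l k' by (simp add: A.dom_comp)
    then show ?thesis
      using slice_prod_conn_relI[of h P l A] h l by simp
  qed
  have lift_at: "\<exists>k. k \<in> Arr ?A \<and> Cod ?A k = a \<and> on_arr (proj A) k = on_arr (proj U) f"
    if "f \<in> Arr ?U" "a \<in> Obj ?A" "on_obj (proj U) (Cod ?U f) = on_obj (proj A) a" for f a
    using lift_ex[OF that(2) U_s(2)[OF that(1)]] U_s(4)[OF that(1)] that(3) by simp
  have S_conn: "(s, t) \<in> conn_rel ?C" if sd: "s \<in> S d" and td: "t \<in> S d" for s t d
  proof -
    obtain p f k where s: "s = (p, Dom ?A k)" "(p, f) \<in> ?T" "Cod ?U f = fst d"
      "k \<in> Arr ?A" "Cod ?A k = snd d" "on_arr (proj A) k = on_arr (proj U) f"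
      using sd by (auto simp: S_def)
    obtain p' f' k' where t: "t = (p', Dom ?A k')" "(p', f') \<in> ?T" "Cod ?U f' = fst d"
      "k' \<in> Arr ?A" "Cod ?A k' = snd d" "on_arr (proj A) k' = on_arr (proj U) f'"
      using td by (auto simp: S_def)
    have "((p, f), (p', f')) \<in> ?R"
      using init s(2,3) t(2,3) unfolding initial_funct_def by metis
    define lifts where "lifts g l \<longleftrightarrow> l \<in> Arr ?A \<and> Cod ?A l = snd d
      \<and> on_arr (proj A) l = on_arr (proj U) g" for g l
    \<comment> \<open>The induction follows the zigzag from \<open>(p, f)\<close>. Existence of a
      lift at the current vertex is carried along, since the next step connects through it.\<close>
    have main: "(\<exists>l. lifts (snd w) l) \<and> (\<forall>l. lifts (snd w) l \<longrightarrow> ((fst v, Dom ?A k), (fst w, Dom ?A l)) \<in> conn_rel ?C)"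
      if "(v, w) \<in> ?R" "v = (p, f)" for v w
      using that
    proof (induction rule: comma_rel_induct)
      case (refl v)
      then show ?case
        using s lift_unique conn_rel_refl unfolding lifts_def by (metis fst_conv snd_conv)
    next
      case (step v w w')
      then obtain l where l: "lifts (snd w) l" "((fst v, Dom ?A k), (fst w, Dom ?A l)) \<in> conn_rel ?C"
        by blast
      have w': "snd w' \<in> Arr ?U" "Cod ?U (snd w') = Cod ?U (snd w)" "snd w \<in> Arr ?U"
        using step(1) eta_s(2,4) by (auto simp: comma_step_def U.comp_in_Arr U.cod_comp)
      have "on_obj (proj U) (Cod ?U (snd w')) = on_obj (proj A) (snd d)"
        using l(1) w' U_s(4)[OF w'(3)] A_s(4) unfolding lifts_def by metis
      then have "\<exists>l'. lifts (snd w') l'"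
        using lift_at[OF w'(1), of "snd d"] l(1) A.cod_in_Obj unfolding lifts_def by metis
      moreover have "((fst w, Dom ?A l), (fst w', Dom ?A l')) \<in> conn_rel ?C" if "lifts (snd w') l'" for l'
        using step(1)
      proof
        assume "(w, w') \<in> comma_step ?P ?U eta"
        then show ?thesis
          using comma_step_conn[of "fst w" "snd w" "fst w'" "snd w'" l l'] l(1) that
          by (simp add: lifts_def)
      next
        assume "(w', w) \<in> comma_step ?P ?U eta"
        then show ?thesis
          using comma_step_conn[of "fst w'" "snd w'" "fst w" "snd w" l' l] l(1) that
          by (simp add: lifts_def conn_rel_sym)
      qed
      ultimately show ?case
        using l(2) by (metis conn_rel_trans)
    qed
    show ?thesis
      using main[OF \<open>((p, f), (p', f')) \<in> ?R\<close> refl] t s(1) by (simp add: lifts_def)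
  qed
  have S_nonempty: "S (u, a) \<noteq> {}"
    if "u \<in> Obj ?U" "a \<in> Obj ?A" "on_obj (proj U) u = on_obj (proj A) a" for u a
  proof -
    obtain p f where "(p, f) \<in> ?T" "Cod ?U f = u"
      using init \<open>u \<in> Obj ?U\<close> by (auto simp: initial_funct_def)
    then show ?thesis
      using lift_at[of f a] that by (auto simp: S_def comma_obj_def)
  qed
  \<comment> \<open>Saturating all of \<open>S d\<close> avoids choosing \<open>f\<close> and
    \<open>k\<close>; by \<open>S_conn\<close> the result is the class of any member.\<close>
  define \<phi> where "\<phi> d = conn_rel ?C `` S d" for d
  have \<phi>_eqI: "\<phi> d = conn_rel ?C `` {s}" if "s \<in> S d" for s d
  proof -
    have "(s, x) \<in> conn_rel ?C" if "t \<in> S d" "(t, x) \<in> conn_rel ?C" for t x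
      using S_conn[OF \<open>s \<in> S d\<close> that(1)] that(2) by (rule conn_rel_trans)
    then show ?thesis
      using \<open>s \<in> S d\<close> unfolding \<phi>_def by auto
  qed
  \<comment> \<open>Composing \<open>f\<close> with \<open>g\<close> and \<open>k\<close> with
    \<open>l\<close> leaves \<open>p\<close> and \<open>Dom k\<close> unchanged, so the candidate
    sets at both ends of the arrow share an element.\<close>
  have \<phi>_arr: "\<phi> (Dom ?D m) = \<phi> (Cod ?D m)" if mD: "m \<in> Arr ?D" for m
  proof -
    obtain g l where m: "m = (g, l)" "g \<in> Arr ?U" "l \<in> Arr ?A" "on_arr (proj U) g = on_arr (proj A) l"
      using mD by (auto simp: slice_prod_simps)
    have "on_obj (proj U) (Dom ?U g) = on_obj (proj A) (Dom ?A l)"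
      using m U_s(3) A_s(3) by metis
    then obtain p f k where s: "(p, f) \<in> ?T" "Cod ?U f = Dom ?U g" "k \<in> Arr ?A"
      "Cod ?A k = Dom ?A l" "on_arr (proj A) k = on_arr (proj U) f"
      using S_nonempty[OF U.dom_in_Obj[OF m(2)] A.dom_in_Obj[OF m(3)]] by (auto simp: S_def)
    then have 1: "(p, Dom ?A k) \<in> S (Dom ?D m)"
      using m by (auto simp: S_def slice_prod_simps)
    have f: "f \<in> Arr ?U" "p \<in> Obj ?P" "Dom ?U f = on_obj eta p"
      using s by (auto simp: comma_obj_def)
    have "(p, Comp ?U g f) \<in> ?T" "Cod ?U (Comp ?U g f) = Cod ?U g" "Comp ?A l k \<in> Arr ?A"
      "Cod ?A (Comp ?A l k) = Cod ?A l" "Dom ?A (Comp ?A l k) = Dom ?A k"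
      "on_arr (proj A) (Comp ?A l k) = on_arr (proj U) (Comp ?U g f)"
      using s f m A_s(6) U_s(6)
      by (auto simp: comma_obj_def U.comp_in_Arr U.dom_comp U.cod_comp A.comp_in_Arr A.dom_comp A.cod_comp)
    then have 2: "(p, Dom ?A k) \<in> S (Cod ?D m)"
      using S_I m(1) by (simp add: slice_prod_simps)
    show ?thesis using \<phi>_eqI[OF 1] \<phi>_eqI[OF 2] by simp
  qed
  have \<phi>_eta: "\<phi> (on_obj eta p, a) = conn_rel ?C `` {(p, a)}"
    if pa: "p \<in> Obj ?P" "a \<in> Obj ?A" "on_obj (proj P) p = on_obj (proj A) a" for p a
  \<comment> \<open>Identities serve as \<open>f\<close> and \<open>k\<close>, so
    \<open>(p, a)\<close> is itself a candidate.\<close>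
  proof (rule \<phi>_eqI)
    have "(p, Ide ?U (on_obj eta p)) \<in> ?T" "Cod ?U (Ide ?U (on_obj eta p)) = on_obj eta p"
      "Ide ?A a \<in> Arr ?A" "Dom ?A (Ide ?A a) = a" "Cod ?A (Ide ?A a) = a"
      "on_arr (proj A) (Ide ?A a) = on_arr (proj U) (Ide ?U (on_obj eta p))"
      using pa eta_s(1) eta_X(1) A_s(5) U_s(5)
      by (auto simp: comma_obj_def U.ide_in_Arr U.dom_ide U.cod_ide A.ide_in_Arr A.dom_ide A.cod_ide)
    then show "(p, a) \<in> S (on_obj eta p, a)"
      by (intro S_I)
  qed
  note ten_class = ten_map_class[OF eta id_funct_in_slice_hom[OF A']]
  have ten_class': "ten_map U A eta (id_funct ?A) (conn_rel ?C `` {(p, a)}) = conn_rel ?D `` {(on_obj eta p, a)}"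
    if "a \<in> Obj ?A" for p a
    using that unfolding ten_class by (simp add: id_funct_def)
  show ?thesis
    unfolding bij_betw_def
  proof (intro conjI)
    show "inj_on (ten_map U A eta (id_funct ?A)) (ten P A)"
    proof (rule inj_onI)
      fix t t' assume t: "t \<in> ten P A" "t' \<in> ten P A"
        and eq: "ten_map U A eta (id_funct ?A) t = ten_map U A eta (id_funct ?A) t'"
      obtain p a where pa: "p \<in> Obj ?P" "a \<in> Obj ?A" "on_obj (proj P) p = on_obj (proj A) a"
        "t = conn_rel ?C `` {(p, a)}"
        using t(1) by (rule ten_cases)
      obtain p' a' where pa': "p' \<in> Obj ?P" "a' \<in> Obj ?A" "on_obj (proj P) p' = on_obj (proj A) a'"
        "t' = conn_rel ?C `` {(p', a')}"
        using t(2) by (rule ten_cases)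
      have "((on_obj eta p, a), (on_obj eta p', a')) \<in> conn_rel ?D"
        using eq pa pa' by (simp add: ten_class' conn_rel_Image_eq_iff)
      then have "\<phi> (on_obj eta p, a) = \<phi> (on_obj eta p', a')"
        using \<phi>_arr by (rule conn_rel_invariant)
      then show "t = t'" using pa pa' \<phi>_eta by simp
    qed
    show "ten_map U A eta (id_funct ?A) ` ten P A = ten U A"
    proof (intro equalityI subsetI)
      fix t assume "t \<in> ten_map U A eta (id_funct ?A) ` ten P A"
      then obtain p a where pa: "p \<in> Obj ?P" "a \<in> Obj ?A" "on_obj (proj P) p = on_obj (proj A) a"
        "t = conn_rel ?D `` {(on_obj eta p, a)}"
        by (auto elim!: ten_cases simp: ten_class')
      then show "t \<in> ten U A"
        using class_in_ten eta_s(1) eta_X(1) by metis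
    next
      fix t assume "t \<in> ten U A"
      then obtain u a where ua: "u \<in> Obj ?U" "a \<in> Obj ?A" "on_obj (proj U) u = on_obj (proj A) a"
        "t = conn_rel ?D `` {(u, a)}"
        by (rule ten_cases)
      then obtain p f k where s: "(p, f) \<in> ?T" "Cod ?U f = u" "k \<in> Arr ?A"
        "Cod ?A k = a" "on_arr (proj A) k = on_arr (proj U) f"
        using S_nonempty[OF ua(1-3)] by (auto simp: S_def)
      have f: "f \<in> Arr ?U" "p \<in> Obj ?P" "Dom ?U f = on_obj eta p"
        using s by (auto simp: comma_obj_def)
      \<comment> \<open>The pair \<open>(f, k)\<close> is an arrow of the product that connects an
        image point to \<open>(u, a)\<close>.\<close>
      have "((on_obj eta p, Dom ?A k), (u, a)) \<in> conn_rel ?D"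
        using slice_prod_conn_relI[of f U k A] s f by simp
      then have "t = ten_map U A eta (id_funct ?A) (conn_rel ?C `` {(p, Dom ?A k)})"
        using ua s by (simp add: ten_class' A.dom_in_Obj conn_rel_Image_eq_iff conn_rel_sym)
      moreover have "conn_rel ?C `` {(p, Dom ?A k)} \<in> ten P A"
        using f s A_s(3) U_s(3) eta_X(1) by (intro class_in_ten) (auto simp: A.dom_in_Obj, metis)
      ultimately show "t \<in> ten_map U A eta (id_funct ?A) ` ten P A" by blast
    qed
  qed
qed

lemma bij_betw_ten_map_unit:
  fixes X :: "('u, 'u) cat" and P U :: "('u, 'u, 'u, 'u) over"
  assumes "infinite (UNIV :: 'u set)"
    and "P \<in> slice_obj X" "U \<in> disc_opfibs X" "eta \<in> slice_hom P U"
    and "\<And>(Q :: ('u, 'u, 'u, 'u) over) F. \<lbrakk>Q \<in> disc_opfibs X; F \<in> slice_hom P Q\<rbrakk>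
      \<Longrightarrow> \<exists>!G. G \<in> slice_hom U Q \<and> comp_funct (tot P) G eta = F"
    and "A \<in> disc_fibs X"
  shows "bij_betw (ten_map U A eta (id_funct (tot A))) (ten P A) (ten U A)"
  using bij_betw_ten_map_initial[OF assms(2) _ assms(6,4) unit_initial[OF assms(1-5)]] assms(3)
  by (simp add: disc_opfibs_def)

section \<open>Opposites\<close>

definition op_cat :: "('o, 'a) cat \<Rightarrow> ('o, 'a) cat" where
  "op_cat C = \<lparr>Obj = Obj C, Arr = Arr C, Dom = Cod C, Cod = Dom C, Ide = Ide C,
     Comp = (\<lambda>g f. Comp C f g)\<rparr>"

definition op_over :: "('o, 'a, 'x, 'y) over \<Rightarrow> ('o, 'a, 'x, 'y) over" where
  "op_over P = \<lparr>tot = op_cat (tot P), proj = proj P\<rparr>"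

lemma op_cat_simps [simp]:
  "Obj (op_cat C) = Obj C" "Arr (op_cat C) = Arr C" "Dom (op_cat C) = Cod C"
  "Cod (op_cat C) = Dom C" "Ide (op_cat C) = Ide C" "Comp (op_cat C) g f = Comp C f g"
  by (simp_all add: op_cat_def)

lemma op_over_simps [simp]: "tot (op_over P) = op_cat (tot P)" "proj (op_over P) = proj P"
  by (simp_all add: op_over_def)

lemma op_op_cat [simp]: "op_cat (op_cat C) = C"
  by (simp add: op_cat_def)

lemma op_op_over [simp]: "op_over (op_over P) = P"
  by (simp add: op_over_def)

lemma category_op: "category C \<Longrightarrow> category (op_cat C)"
  by (simp add: category_def)

lemma category_op_iff [simp]: "category (op_cat C) \<longleftrightarrow> category C"
  using category_op op_op_cat by metis

text \<open>A functor and its opposite are the same record, so units, slice morphisms and tensor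
  maps carry over to opposites unchanged.\<close>

lemma functs_op [simp]: "functs (op_cat C) (op_cat D) = functs C D"
  unfolding functs_def by (simp, safe, auto)

lemma comp_funct_op [simp]: "comp_funct (op_cat C) = comp_funct C"
  by (simp add: comp_funct_def fun_eq_iff)

lemma id_funct_op [simp]: "id_funct (op_cat C) = id_funct C"
  by (simp add: id_funct_def)

lemma slice_obj_op [simp]: "op_over P \<in> slice_obj (op_cat X) \<longleftrightarrow> P \<in> slice_obj X"
  by (simp add: slice_obj_def)

lemma slice_hom_op [simp]: "slice_hom (op_over P) (op_over Q) = slice_hom P Q"
  by (simp add: slice_hom_def)

lemma disc_opfibs_op [simp]: "op_over P \<in> disc_opfibs (op_cat X) \<longleftrightarrow> P \<in> disc_fibs X"
  by (simp add: disc_opfibs_def disc_fibs_def)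

lemma disc_fibs_op [simp]: "op_over P \<in> disc_fibs (op_cat X) \<longleftrightarrow> P \<in> disc_opfibs X"
  by (simp add: disc_opfibs_def disc_fibs_def)

text \<open>The generating relation is symmetrised, so reversing arrows does not affect
  components.\<close>

lemma conn_rel_op [simp]: "conn_rel (op_cat C) = conn_rel C"
proof -
  have "{(Cod C f, Dom C f) |f. f \<in> Arr C} = {(Dom C f, Cod C f) |f. f \<in> Arr C}\<inverse>"
    by auto
  then show ?thesis
    by (simp add: conn_rel_def Let_def Un_commute)
qed

lemma slice_prod_op: "tot (slice_prod (op_over P) (op_over Q)) = op_cat (tot (slice_prod P Q))"
  by (auto simp: slice_prod_def op_cat_def Let_def fun_eq_iff)

lemma ten_op [simp]: "ten (op_over P) (op_over Q) = ten P Q"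
  by (simp add: ten_def components_def slice_prod_op)

lemma ten_map_op [simp]: "ten_map (op_over P) (op_over Q) = ten_map P Q"
  by (simp add: ten_map_def slice_prod_op fun_eq_iff)

lemma bij_betw_ten_map_unit_dual:
  fixes X :: "('u, 'u) cat" and P U :: "('u, 'u, 'u, 'u) over"
  assumes inf: "infinite (UNIV :: 'u set)"
    and P: "P \<in> slice_obj X" and U: "U \<in> disc_fibs X" and eta: "eta \<in> slice_hom P U"
    and univ: "\<And>(Q :: ('u, 'u, 'u, 'u) over) F. \<lbrakk>Q \<in> disc_fibs X; F \<in> slice_hom P Q\<rbrakk>
      \<Longrightarrow> \<exists>!G. G \<in> slice_hom U Q \<and> comp_funct (tot P) G eta = F"
    and D: "D \<in> disc_opfibs X"
  shows "bij_betw (ten_map U D eta (id_funct (tot D))) (ten P D) (ten U D)"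
proof -
  have "\<exists>!G. G \<in> slice_hom (op_over U) Q \<and> comp_funct (tot (op_over P)) G eta = F"
    if "Q \<in> disc_opfibs (op_cat X)" "F \<in> slice_hom (op_over P) Q"
    for Q :: "('u, 'u, 'u, 'u) over" and F
    \<comment> \<open>Since \<open>op_over\<close> is an involution, \<open>Q\<close> is the
      opposite of the discrete fibration \<open>op_over Q\<close> over \<open>X\<close>, to which
      the given universal property applies.\<close>
    using univ[of "op_over Q" F] that disc_opfibs_op[of "op_over Q" X]
      slice_hom_op[of P "op_over Q"] slice_hom_op[of U "op_over Q"] by simp
  then have "bij_betw (ten_map (op_over U) (op_over D) eta (id_funct (tot (op_over D))))
      (ten (op_over P) (op_over D)) (ten (op_over U) (op_over D))"
    using P U eta D by (intro bij_betw_ten_map_unit[OF inf, where X = "op_cat X"]) auto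
  then show ?thesis by simp
qed

section \<open>Naturality and the two families of bijections\<close>

lemma ten_map_unit_natural:
  assumes adj: "left_adjoint_of_inclusion X S L Lm eta"
    and P: "P \<in> slice_obj X" "P' \<in> slice_obj X" and A: "A \<in> slice_obj X" "A' \<in> slice_obj X"
    and F: "F \<in> slice_hom P P'" and G: "G \<in> slice_hom A A'" and t: "t \<in> ten P A"
  shows "ten_map (L P') A' (eta P') (id_funct (tot A')) (ten_map P' A' F G t)
    = ten_map (L P') A' (Lm P P' F) G (ten_map (L P) A (eta P) (id_funct (tot A)) t)"
proof -
  interpret left_adjoint_of_inclusion X S L Lm eta by fact
  note cat = slice_objD(1)[OF P(1)] slice_objD(1)[OF A(1)]
  note ids = id_funct_in_slice_hom[OF A(1)] id_funct_in_slice_hom[OF A(2)]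
  show ?thesis
    \<comment> \<open>By functoriality of \<open>ten\<close>, both sides are the action of one pair
      of morphisms; naturality of \<open>eta\<close> and the identity laws make the two pairs
      equal.\<close>
    unfolding ten_map_comp[OF cat F G eta_in[OF P(2)] ids(2) t]
      ten_map_comp[OF cat eta_in[OF P(1)] ids(1) Lm_in[OF P F] G t]
      eta_natural[OF P F] comp_id_funct_left[OF slice_homD(1)[OF G]]
      comp_id_funct_right[OF slice_homD(1)[OF G]] ..
qed

theorem proposition15:
  fixes X :: "('u, 'u) cat"
    and down up :: "('u, 'u, 'u, 'u) over \<Rightarrow> ('u, 'u, 'u, 'u) over"
    and downm upm :: "('u, 'u, 'u, 'u) over \<Rightarrow> ('u, 'u, 'u, 'u) over
      \<Rightarrow> ('u, 'u, 'u, 'u) funct \<Rightarrow> ('u, 'u, 'u, 'u) funct"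
    and eta_down eta_up :: "('u, 'u, 'u, 'u) over \<Rightarrow> ('u, 'u, 'u, 'u) funct"
  assumes "infinite (UNIV :: 'u set)"
    and "category X"
    and "left_adjoint_of_inclusion X (disc_fibs X) down downm eta_down"
    and "left_adjoint_of_inclusion X (disc_opfibs X) up upm eta_up"
  shows
    "(\<exists>\<beta> :: ('u, 'u, 'u, 'u) over \<Rightarrow> ('u, 'u, 'u, 'u) over \<Rightarrow> ('u \<times> 'u) set \<Rightarrow> ('u \<times> 'u) set.
        (\<forall>P\<in>slice_obj X. \<forall>A\<in>disc_fibs X. bij_betw (\<beta> P A) (ten P A) (ten (up P) A)) \<and>
        (\<forall>P\<in>slice_obj X. \<forall>P'\<in>slice_obj X. \<forall>A\<in>disc_fibs X. \<forall>A'\<in>disc_fibs X.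
          \<forall>F\<in>slice_hom P P'. \<forall>G\<in>slice_hom A A'. \<forall>t\<in>ten P A.
            \<beta> P' A' (ten_map P' A' F G t) = ten_map (up P') A' (upm P P' F) G (\<beta> P A t)))
   \<and> (\<exists>\<gamma> :: ('u, 'u, 'u, 'u) over \<Rightarrow> ('u, 'u, 'u, 'u) over \<Rightarrow> ('u \<times> 'u) set \<Rightarrow> ('u \<times> 'u) set.
        (\<forall>P\<in>slice_obj X. \<forall>D\<in>disc_opfibs X. bij_betw (\<gamma> P D) (ten P D) (ten (down P) D)) \<and>
        (\<forall>P\<in>slice_obj X. \<forall>P'\<in>slice_obj X. \<forall>D\<in>disc_opfibs X. \<forall>D'\<in>disc_opfibs X.
          \<forall>F\<in>slice_hom P P'. \<forall>G\<in>slice_hom D D'. \<forall>t\<in>ten P D.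
            \<gamma> P' D' (ten_map P' D' F G t) = ten_map (down P') D' (downm P P' F) G (\<gamma> P D t)))"
proof (intro conjI)
  interpret down: left_adjoint_of_inclusion X "disc_fibs X" down downm eta_down by fact
  interpret up: left_adjoint_of_inclusion X "disc_opfibs X" up upm eta_up by fact
  show "\<exists>\<beta> :: ('u, 'u, 'u, 'u) over \<Rightarrow> ('u, 'u, 'u, 'u) over \<Rightarrow> ('u \<times> 'u) set \<Rightarrow> ('u \<times> 'u) set.
        (\<forall>P\<in>slice_obj X. \<forall>A\<in>disc_fibs X. bij_betw (\<beta> P A) (ten P A) (ten (up P) A)) \<and>
        (\<forall>P\<in>slice_obj X. \<forall>P'\<in>slice_obj X. \<forall>A\<in>disc_fibs X. \<forall>A'\<in>disc_fibs X.
          \<forall>F\<in>slice_hom P P'. \<forall>G\<in>slice_hom A A'. \<forall>t\<in>ten P A.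
            \<beta> P' A' (ten_map P' A' F G t) = ten_map (up P') A' (upm P P' F) G (\<beta> P A t))"
  \<comment> \<open>Taking the action of \<open>ten\<close> on the unit as witness makes naturality
    an instance of \<open>ten_map_unit_natural\<close>.\<close>
  proof (rule exI[of _ "\<lambda>P A. ten_map (up P) A (eta_up P) (id_funct (tot A))"], intro conjI ballI)
    fix P A :: "('u, 'u, 'u, 'u) over"
    assume P: "P \<in> slice_obj X" and A: "A \<in> disc_fibs X"
    show "bij_betw (ten_map (up P) A (eta_up P) (id_funct (tot A))) (ten P A) (ten (up P) A)"
      using up.eta_universal[OF P]
      by (rule bij_betw_ten_map_unit[OF assms(1) P up.L_in[OF P] up.eta_in[OF P] _ A])
  qed (rule ten_map_unit_natural[OF assms(4)]; simp add: disc_fibs_def)+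
  show "\<exists>\<gamma> :: ('u, 'u, 'u, 'u) over \<Rightarrow> ('u, 'u, 'u, 'u) over \<Rightarrow> ('u \<times> 'u) set \<Rightarrow> ('u \<times> 'u) set.
        (\<forall>P\<in>slice_obj X. \<forall>D\<in>disc_opfibs X. bij_betw (\<gamma> P D) (ten P D) (ten (down P) D)) \<and>
        (\<forall>P\<in>slice_obj X. \<forall>P'\<in>slice_obj X. \<forall>D\<in>disc_opfibs X. \<forall>D'\<in>disc_opfibs X.
          \<forall>F\<in>slice_hom P P'. \<forall>G\<in>slice_hom D D'. \<forall>t\<in>ten P D.
            \<gamma> P' D' (ten_map P' D' F G t) = ten_map (down P') D' (downm P P' F) G (\<gamma> P D t))"
  proof (rule exI[of _ "\<lambda>P D. ten_map (down P) D (eta_down P) (id_funct (tot D))"], intro conjI ballI)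
    fix P D :: "('u, 'u, 'u, 'u) over"
    assume P: "P \<in> slice_obj X" and D: "D \<in> disc_opfibs X"
    show "bij_betw (ten_map (down P) D (eta_down P) (id_funct (tot D))) (ten P D) (ten (down P) D)"
      using down.eta_universal[OF P]
      by (rule bij_betw_ten_map_unit_dual[OF assms(1) P down.L_in[OF P] down.eta_in[OF P] _ D])
  qed (rule ten_map_unit_natural[OF assms(3)]; simp add: disc_opfibs_def)+
qed

end
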